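(* Let $\mathbf{A}\in\mathbb{R}^{N\times N}$ be diagonalizable with eigendecomposition $\mathbf{A}=\mathbf{V}\boldsymbol{\Lambda}\mathbf{V}^{-1}$, and let $\mathbf{A}_e=\mathbf{V}\boldsymbol{\Lambda}_e\mathbf{V}^{-1}$ with $\boldsymbol{\Lambda}_e=\mathrm{diag}(\lambda_{e_1},\dots,\lambda_{e_N})$, $\lambda_{e_k}=e^{-j2\pi(k-1)/N}$ for $k=1,\dots,N$. Then $\mathbf{A}_e^N\mathbf{x}=\mathbf{x}$ for every graph signal $\mathbf{x}\in\mathbb{C}^N$.
   Context: A graph on $N$ nodes is given by a real weighted adjacency matrix $\mathbf{A}\in\mathbb{R}^{N\times N}$ (directed or undirected), assumed diagonalizable (over $\mathbb{C}$), $\mathbf{A}=\mathbf{V}\boldsymbol{\Lambda}\mathbf{V}^{-1}$ with $\mathbf{V}\in\mathbb{C}^{N\times N}$ invertible and $\boldsymbol{\Lambda}$ diagonal. A graph signal is a vector in $\mathbb{C}^N$. Here $j=\sqrt{-1}$. *)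

theory Defs
  imports Complex_Main "Jordan_Normal_Form.Matrix"
begin

text \<open>
  Matrices are indexed from \<open>0\<close>, whereas the eigenvalues below are numbered \<open>1, \<dots>, N\<close>;
  hence the \<open>Suc\<close> in \<open>shift_eigenvalue_mat\<close>.
\<close>

definition eigendecomposition ::
  "nat \<Rightarrow> complex mat \<Rightarrow> complex mat \<Rightarrow> complex mat \<Rightarrow> complex mat \<Rightarrow> bool" where
  "eigendecomposition N M V L Vinv \<longleftrightarrow>
     M \<in> carrier_mat N N \<and> V \<in> carrier_mat N N \<and> L \<in> carrier_mat N N \<and> Vinv \<in> carrier_mat N N \<and>
     diagonal_mat L \<and> inverts_mat V Vinv \<and> inverts_mat Vinv V \<and> M = V * L * Vinv"

definition shift_eigenvalue :: "nat \<Rightarrow> nat \<Rightarrow> complex" where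
  "shift_eigenvalue N k = exp (- (\<i> * 2 * of_real pi * (of_nat k - 1) / of_nat N))"

definition shift_eigenvalue_mat :: "nat \<Rightarrow> complex mat" where
  "shift_eigenvalue_mat N = mat_diag N (\<lambda>i. shift_eigenvalue N (Suc i))"

end

theory Submission
  imports Defs
begin

text \<open>Powers commute with conjugation: the N-th power of \<open>A_e\<close> is the N-th power
  of its diagonal factor conjugated by V. The prescribed eigenvalues are N-th roots of unity
  (\<open>shift_eigenvalue_pow\<close>) and diagonal matrices are powered entrywise
  (\<open>mat_diag_pow\<close>), so that factor becomes the identity, and conjugating it gives the
  identity again.\<close>

lemma mat_diag_pow:
  fixes d :: "nat \<Rightarrow> 'a :: semiring_1"
  shows "mat_diag n d ^\<^sub>m k = mat_diag n (\<lambda>i. d i ^ k)"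
  by (induction k) (simp_all add: carrier_matD(1)[OF mat_diag_dim] power_commutes)

lemma shift_eigenvalue_pow: "shift_eigenvalue N (Suc i) ^ N = 1"
proof (cases "N = 0")
  case False
  then have "shift_eigenvalue N (Suc i) ^ N = exp (- (2 * of_nat i * of_real pi * \<i>))"
    \<comment> \<open>The exponent N moves inside \<open>exp\<close> and cancels the division by N,
      which is nonzero here; the \<open>Suc\<close> cancels the \<open>- 1\<close>.\<close>
    by (simp add: shift_eigenvalue_def mult_ac flip: exp_of_nat_mult)
  also have "\<dots> = 1"
    \<comment> \<open>The exponent is purely imaginary, an integer multiple of 2 pi.\<close>
    using cis_multiple_2pi[of "- real i"] by (simp add: exp_eq_polar mult_ac)
  finally show ?thesis .
qed simp

theorem mainTheorem2:
  fixes N :: nat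
    and A :: "real mat"
    and V L Vinv A_e :: "complex mat"
    and x :: "complex vec"
  assumes "A \<in> carrier_mat N N"
    and "eigendecomposition N (map_mat complex_of_real A) V L Vinv"
    and "A_e = V * shift_eigenvalue_mat N * Vinv"
    and "x \<in> carrier_vec N"
  shows "(A_e ^\<^sub>m N) *\<^sub>v x = x"
proof -
  let ?D = "shift_eigenvalue_mat N"
  have V: "V \<in> carrier_mat N N" "Vinv \<in> carrier_mat N N"
    and inv: "V * Vinv = 1\<^sub>m N" "Vinv * V = 1\<^sub>m N"
    using assms(2) by (auto simp: eigendecomposition_def inverts_mat_def)
  have "similar_mat_wit A_e ?D V Vinv"
    using V inv assms(3)
    by (intro similar_mat_witI[of _ _ N]) (auto simp: shift_eigenvalue_mat_def)
  then have "similar_mat_wit (A_e ^\<^sub>m N) (?D ^\<^sub>m N) V Vinv"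
    by (rule similar_mat_wit_pow)
  moreover have "?D ^\<^sub>m N = 1\<^sub>m N"
    by (simp add: shift_eigenvalue_mat_def mat_diag_pow shift_eigenvalue_pow)
  \<comment> \<open>With the middle factor equal to the identity, only V times its inverse
    remains.\<close>
  ultimately have "A_e ^\<^sub>m N = 1\<^sub>m N"
    using V inv by (simp add: similar_mat_wit_def Let_def)
  then show ?thesis
    using assms(4) by simp
qed

end
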